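(* Let $\langle S,R,T,s_I\rangle$ be a discrete-time Markov chain with goal set $G\subseteq S$ such that the expected reachability reward $E_{\diamond G}=\mathbb{E}(\mathit{PR})$ is finite, and let $\overline{|S|}\in\mathbb{N}$, $\overline{r}_{\max}\in\mathbb{R}$, $\underline{p}_{\min}\in\mathbb{R}$ satisfy $\overline{|S|}\ge|S|$, $\overline{r}_{\max}\ge r_{\max}$ and $0<\underline{p}_{\min}\le p_{\min}$. Let $\varepsilon>0$, and choose $q\in\mathbb{N}$ such that $$\overline{|S|}\cdot\overline{r}_{\max}\cdot\bigl(1-(\underline{p}_{\min})^{\overline{|S|}}\bigr)^q\cdot\bigl(q-q\,(\underline{p}_{\min})^{\overline{|S|}}+1\bigr)\cdot(\underline{p}_{\min})^{-\overline{|S|}}<\varepsilon .$$ Then $$B=\{\pi \mid \mathit{idx}(\pi,G)\le q\cdot\overline{|S|}\}$$ is an $\varepsilon$-bounding set for the random variable $\mathit{PR}$.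
   Context: **Discrete-time Markov chain (DTMC).** A tuple $\langle S,R,T,s_I\rangle$ with a finite set of states $S$, a reward function $R:S\to\mathbb{R}_{\ge0}$, an initial state $s_I\in S$, and a transition function $T$ mapping each state to a probability distribution over $S$. A path is an infinite sequence $\pi=s_0s_1\ldots\in S^\omega$ with $s_0=s_I$ and $T(s_i)(s_{i+1})>0$ for all $i$; write $\pi[i]=s_i$. The DTMC induces the usual probability measure $\mathbb{P}$ on sets of paths; $\mathbb{E}$ is expectation with respect to $\mathbb{P}$. **Notation.** $r_{\max}=\max\{R(s)\mid s\in S\}$; $p_{\min}=\min(\{T(s)(s')\mid s,s'\in S\}\setminus\{0\})$; $\mathit{idx}(\pi,G)=\min\{i\in\mathbb{N}\mid s_i\in G\}$, with $\mathit{idx}(\pi,G)=\infty$ if $\pi$ never visits $G$. $\mathbb{N}$ includes $0$. **Reachability reward.** $\mathit{PR}(\pi)=\sum_{i=0}^{\mathit{idx}(\pi,G)}R(\pi[i])$ and $E_{\diamond G}=\mathbb{E}(\mathit{PR})$, where by convention $E_{\diamond G}=\infty$ if $\mathbb{P}(\{\pi\mid\mathit{idx}(\pi,G)=\infty\})>0$. Thus finiteness of $E_{\diamond G}$ entails that $G$ is reached with probability $1$. **$\varepsilon$-bounding set.** Let $(\Omega,\mathcal{F},\mathbb{P})$ be a probability space, $X:\Omega\to\mathbb{R}_{\ge0}$ a random variable with finite expectation, and $B\in\mathcal{F}$. $B$ is an $\varepsilon$-bounding set (for $X$) if (i) $\int_{\Omega\setminus B}X\,\mathrm{d}\mathbb{P}<\varepsilon$,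 and (ii) there are reals $a\le b$ such that $X(\omega)\in[a,b]$ for all $\omega\in B$. *)

theory Defs
  imports "HOL-Probability.Probability"
begin

locale dtmc =
  fixes S :: "'s set" and R :: "'s \<Rightarrow> real" and T :: "'s \<Rightarrow> 's pmf" and s\<^sub>I :: 's
  assumes finite_S: "finite S"
    and R_nonneg: "\<And>s. s \<in> S \<Longrightarrow> 0 \<le> R s"
    and T_closed: "\<And>s. s \<in> S \<Longrightarrow> set_pmf (T s) \<subseteq> S"
    and init_S: "s\<^sub>I \<in> S"

definition paths :: "'s set \<Rightarrow> ('s \<Rightarrow> 's pmf) \<Rightarrow> 's \<Rightarrow> (nat \<Rightarrow> 's) set" where
  "paths S T s\<^sub>I =
     {\<pi>. (\<forall>i. \<pi> i \<in> S) \<and> \<pi> 0 = s\<^sub>I \<and> (\<forall>i. 0 < pmf (T (\<pi> i)) (\<pi> (Suc i)))}"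

definition words :: "'s set \<Rightarrow> 's \<Rightarrow> 's list set" where
  "words S s\<^sub>I = {w. w \<noteq> [] \<and> hd w = s\<^sub>I \<and> set w \<subseteq> S}"

definition cylinder :: "'s set \<Rightarrow> ('s \<Rightarrow> 's pmf) \<Rightarrow> 's \<Rightarrow> 's list \<Rightarrow> (nat \<Rightarrow> 's) set" where
  "cylinder S T s\<^sub>I w = {\<pi> \<in> paths S T s\<^sub>I. \<forall>i<length w. \<pi> i = w ! i}"

definition word_prob :: "('s \<Rightarrow> 's pmf) \<Rightarrow> 's list \<Rightarrow> real" where
  "word_prob T w = (\<Prod>i<length w - 1. pmf (T (w ! i)) (w ! Suc i))"

text \<open>
  The usual path measure: the probability measure on the \<open>\<sigma>\<close>-algebra generated by the
  cylinder sets that gives every cylinder the product of its transition probabilities.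
  \<^const>\<open>extend_measure\<close> degenerates to the zero measure if no such extension exists; the lemmas
  \<open>prob_space_path_measure\<close>, \<open>emeasure_cylinder\<close> and \<open>path_measure_unique\<close> below show that it
  exists and is unique.
\<close>

definition path_measure :: "'s set \<Rightarrow> ('s \<Rightarrow> 's pmf) \<Rightarrow> 's \<Rightarrow> (nat \<Rightarrow> 's) measure" where
  "path_measure S T s\<^sub>I =
     extend_measure (paths S T s\<^sub>I) (words S s\<^sub>I) (cylinder S T s\<^sub>I) (\<lambda>w. ennreal (word_prob T w))"

definition r_max :: "'s set \<Rightarrow> ('s \<Rightarrow> real) \<Rightarrow> real" where
  "r_max S R = Max {R s | s. s \<in> S}"

definition p_min :: "'s set \<Rightarrow> ('s \<Rightarrow> 's pmf) \<Rightarrow> real" where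
  "p_min S T = Min ({pmf (T s) s' | s s'. s \<in> S \<and> s' \<in> S} - {0})"

text \<open>The infimum of the empty set in \<^typ>\<open>enat\<close> is \<open>\<infinity>\<close>.\<close>

definition idx :: "(nat \<Rightarrow> 's) \<Rightarrow> 's set \<Rightarrow> enat" where
  "idx \<pi> G = (INF i\<in>{i. \<pi> i \<in> G}. enat i)"

text \<open>
  A path that never visits \<open>G\<close> accumulates all of its rewards, possibly infinitely much; hence
  the value is an extended nonnegative real. It is finite whenever \<open>G\<close> is visited.
\<close>

definition PR :: "('s \<Rightarrow> real) \<Rightarrow> 's set \<Rightarrow> (nat \<Rightarrow> 's) \<Rightarrow> ennreal" where
  "PR R G \<pi> = (\<Sum>i. if enat i \<le> idx \<pi> G then ennreal (R (\<pi> i)) else 0)"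

definition expected_reach_reward ::
    "'s set \<Rightarrow> ('s \<Rightarrow> real) \<Rightarrow> ('s \<Rightarrow> 's pmf) \<Rightarrow> 's \<Rightarrow> 's set \<Rightarrow> ennreal" where
  "expected_reach_reward S R T s\<^sub>I G =
     (if emeasure (path_measure S T s\<^sub>I) {\<pi> \<in> paths S T s\<^sub>I. idx \<pi> G = \<infinity>} > 0 then \<infinity>
      else \<integral>\<^sup>+\<pi>. PR R G \<pi> \<partial>path_measure S T s\<^sub>I)"

text \<open>
  The random variable may take the value \<open>\<infinity>\<close>, so that \<^const>\<open>PR\<close> is covered; for
  real-valued nonnegative \<open>X\<close> this is the ordinary notion. The comparison is made in
  \<^typ>\<open>ereal\<close> because \<^const>\<open>ennreal\<close> truncates negative reals to \<open>0\<close>.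
\<close>

definition bounding_set :: "'a measure \<Rightarrow> real \<Rightarrow> ('a \<Rightarrow> ennreal) \<Rightarrow> 'a set \<Rightarrow> bool" where
  "bounding_set M \<epsilon> X B \<longleftrightarrow>
     prob_space M \<and> X \<in> borel_measurable M \<and> (\<integral>\<^sup>+\<omega>. X \<omega> \<partial>M) < \<infinity> \<and> B \<in> sets M \<and>
     (\<integral>\<^sup>+\<omega>\<in>space M - B. X \<omega> \<partial>M) < ennreal \<epsilon> \<and>
     (\<exists>a b::real. a \<le> b \<and> (\<forall>\<omega>\<in>B. ereal a \<le> enn2ereal (X \<omega>) \<and> enn2ereal (X \<omega>) \<le> ereal b))"

lemma cylinder_subset: "cylinder S T s\<^sub>I w \<subseteq> paths S T s\<^sub>I"
  by (auto simp: cylinder_def)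

lemma space_path_measure [simp]: "space (path_measure S T s\<^sub>I) = paths S T s\<^sub>I"
  unfolding path_measure_def by (rule space_extend_measure) (auto simp: cylinder_def)

lemma sets_path_measure:
  "sets (path_measure S T s\<^sub>I) = sigma_sets (paths S T s\<^sub>I) (cylinder S T s\<^sub>I ` words S s\<^sub>I)"
  unfolding path_measure_def by (rule sets_extend_measure) (auto simp: cylinder_def)

definition trans_kernel :: "('s \<Rightarrow> 's pmf) \<Rightarrow> 's \<Rightarrow> nat \<Rightarrow> (nat \<Rightarrow> 's) \<Rightarrow> 's measure" where
  "trans_kernel T s\<^sub>I n \<omega> = measure_pmf (case n of 0 \<Rightarrow> return_pmf s\<^sub>I | Suc m \<Rightarrow> T (\<omega> m))"

lemma Ionescu_Tulcea_trans_kernel: "Ionescu_Tulcea (trans_kernel T s\<^sub>I) (\<lambda>_. count_space UNIV)"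
proof (rule Ionescu_Tulcea.intro)
  fix i
  show "trans_kernel T s\<^sub>I i \<in> measurable (Pi\<^sub>M {0..<i} (\<lambda>_. count_space UNIV)) (subprob_algebra (count_space UNIV))"
  proof (cases i)
    case 0
    then show ?thesis
      by (auto simp: trans_kernel_def[abs_def] measure_pmf_in_subprob_algebra)
  next
    case (Suc m)
    have "(\<lambda>s. measure_pmf (T s)) \<in> measurable (count_space UNIV) (subprob_algebra (count_space UNIV))"
      by (auto simp: measure_pmf_in_subprob_algebra)
    then have "(\<lambda>\<omega>. measure_pmf (T (\<omega> m))) \<in> measurable (Pi\<^sub>M {0..<i} (\<lambda>_. count_space UNIV)) (subprob_algebra (count_space UNIV))"
      by (rule measurable_compose[rotated]) (auto simp: Suc intro!: measurable_component_singleton)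
    then show ?thesis
      by (simp add: trans_kernel_def[abs_def] Suc)
  qed
next
  show "prob_space (trans_kernel T s\<^sub>I i \<omega>)" for i \<omega>
    unfolding trans_kernel_def by (rule prob_space_measure_pmf)
qed

context dtmc
begin

interpretation IT: Ionescu_Tulcea "trans_kernel T s\<^sub>I" "\<lambda>_. count_space UNIV"
  by (rule Ionescu_Tulcea_trans_kernel)

abbreviation (input) "W n \<equiv> Pi\<^sub>M {0..<n::nat} (\<lambda>_. count_space (UNIV :: 's set))"

lemma sets_single:
  assumes "f \<in> extensional {0..<n}" shows "{f} \<in> sets (W n)"
proof -
  have "{f} = Pi\<^sub>E {0..<n} (\<lambda>i. {f i})"
    using PiE_singleton[OF assms] by simp
  also have "\<dots> \<in> sets (W n)"
    by (intro sets_PiM_I_finite) auto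
  finally show ?thesis .
qed

lemma space_W: "space (W n) = extensional {0..<n}"
  by (auto simp: space_PiM PiE_def)

lemma emeasure_C_single:
  assumes "f \<in> extensional {0..<Suc n}" "f 0 = s\<^sub>I"
  shows "emeasure (IT.C 0 (Suc n) (\<lambda>_. undefined)) {f} = ennreal (\<Prod>i<n. pmf (T (f i)) (f (Suc i)))"
  using assms
proof (induction n arbitrary: f)
  case 0
  have u: "(\<lambda>_. undefined) \<in> space (W 0)" by (simp add: space_W)
  have e: "(\<lambda>x. (\<lambda>_. undefined)(0 := x)) -` {f} = {s\<^sub>I}"
    using 0 by (force simp: fun_eq_iff extensional_def)
  have C: "IT.C 0 (Suc 0) (\<lambda>_. undefined) = IT.eP 0 (\<lambda>_. undefined)"
    using u IT.measurable_eP[of 0] by (simp add: bind_return)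
  have "emeasure (IT.eP 0 (\<lambda>_. undefined)) {f} = 1"
    using IT.emeasure_eP[OF u sets_single[OF 0(1)]] e
    by (simp add: trans_kernel_def emeasure_pmf_single)
  then show ?case
    unfolding C by simp
next
  case (Suc n)
  let ?f = "restrict f {0..<Suc n}"
  have u: "(\<lambda>_. undefined) \<in> space (W 0)" by (simp add: space_W)
  have sC: "sets (IT.C 0 (Suc n) (\<lambda>_. undefined)) = sets (W (Suc n))"
    using IT.sets_C[OF u, of "Suc n"] by simp
  have spC: "space (IT.C 0 (Suc n) (\<lambda>_. undefined)) = space (W (Suc n))"
    using IT.space_C[OF u, of "Suc n"] by simp
  have A: "{f} \<in> sets (W (Suc (Suc n)))"
    using Suc.prems(1) by (rule sets_single)
  have eP: "emeasure (IT.eP (Suc n) \<omega>) {f} = ennreal (pmf (T (f n)) (f (Suc n))) * indicator {?f} \<omega>"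
    if w: "\<omega> \<in> space (W (Suc n))" for \<omega>
  proof -
    have "emeasure (IT.eP (Suc n) \<omega>) {f} = emeasure (trans_kernel T s\<^sub>I (Suc n) \<omega>) ((fun_upd \<omega> (Suc n)) -` {f})"
      using IT.emeasure_eP[OF w A] by simp
    also have "(fun_upd \<omega> (Suc n)) -` {f} = (if \<omega> = ?f then {f (Suc n)} else {})"
    proof (cases "\<omega> = ?f")
      case True
      have "fun_upd ?f (Suc n) (f (Suc n)) = f"
        using Suc.prems(1) by (auto simp: fun_eq_iff extensional_def)
      then have "fun_upd \<omega> (Suc n) x = f \<longleftrightarrow> x = f (Suc n)" for x
        unfolding True by (metis fun_upd_same)
      then have "(fun_upd \<omega> (Suc n)) -` {f} = {f (Suc n)}"
        by (simp add: vimage_def)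
      then show ?thesis
        using True by (simp only: if_True refl)
    next
      case False
      have "fun_upd \<omega> (Suc n) x \<noteq> f" for x
      proof
        assume *: "fun_upd \<omega> (Suc n) x = f"
        have "\<omega> = ?f"
        using w unfolding *[symmetric] by (auto simp: fun_eq_iff space_W extensional_def)
        with False show False by simp
      qed
      then show ?thesis using False by auto
    qed
    also have "trans_kernel T s\<^sub>I (Suc n) \<omega> = measure_pmf (T (\<omega> n))"
      by (simp add: trans_kernel_def)
    finally have *: "emeasure (IT.eP (Suc n) \<omega>) {f} =
        emeasure (measure_pmf (T (\<omega> n))) (if \<omega> = ?f then {f (Suc n)} else {})" .
    define g where "g = ?f"
    have "g n = f n" by (simp add: g_def)
    with * show ?thesis
      unfolding g_def[symmetric] by (cases "\<omega> = g") (simp_all add: emeasure_pmf_single)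
  qed
  have "emeasure (IT.C 0 (Suc (Suc n)) (\<lambda>_. undefined)) {f} =
      (\<integral>\<^sup>+\<omega>. emeasure (IT.eP (Suc n) \<omega>) {f} \<partial>IT.C 0 (Suc n) (\<lambda>_. undefined))"
  proof -
    have "IT.C 0 (Suc (Suc n)) (\<lambda>_. undefined) = IT.C 0 (Suc n) (\<lambda>_. undefined) \<bind> IT.eP (Suc n)"
      by simp
    moreover have "IT.eP (Suc n) \<in> measurable (IT.C 0 (Suc n) (\<lambda>_. undefined)) (subprob_algebra (W (Suc (Suc n))))"
      using IT.measurable_eP[of "Suc n"] by (simp only: measurable_cong_sets[OF sC refl])
    ultimately show ?thesis
      using spC A by (simp only:) (rule emeasure_bind, auto simp del: IT.C.simps simp: space_W)
  qed
  also have "\<dots> = (\<integral>\<^sup>+\<omega>. ennreal (pmf (T (f n)) (f (Suc n))) * indicator {?f} \<omega> \<partial>IT.C 0 (Suc n) (\<lambda>_. undefined))"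
    by (intro nn_integral_cong eP) (simp only: spC)
  also have "\<dots> = ennreal (pmf (T (f n)) (f (Suc n))) * emeasure (IT.C 0 (Suc n) (\<lambda>_. undefined)) {?f}"
    by (intro nn_integral_cmult_indicator) (simp only: sC sets_single[OF restrict_extensional])
  also have "emeasure (IT.C 0 (Suc n) (\<lambda>_. undefined)) {?f} = ennreal (\<Prod>i<n. pmf (T (?f i)) (?f (Suc i)))"
    by (rule Suc.IH) (rule restrict_extensional, simp add: Suc.prems)
  also have "(\<Prod>i<n. pmf (T (?f i)) (?f (Suc i))) = (\<Prod>i<n. pmf (T (f i)) (f (Suc i)))"
    by (intro prod.cong) auto
  finally show ?case
    by (simp add: ennreal_mult[symmetric] prod_nonneg mult.commute)
qed

definition "seqs = IT.PF.lim"

lemma sets_seqs: "sets seqs = sets (Pi\<^sub>M UNIV (\<lambda>_. count_space (UNIV :: 's set)))"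
  by (simp add: seqs_def)

lemma space_seqs [simp]: "space seqs = UNIV"
  by (simp add: seqs_def space_PiM)

lemma measurable_coord [measurable]: "(\<lambda>\<pi>. \<pi> i) \<in> measurable seqs (count_space UNIV)"
  by (subst measurable_cong_sets[OF sets_seqs refl]) (rule measurable_component_singleton, simp)

lemma pred_coord_eq [measurable]: "Measurable.pred seqs (\<lambda>\<pi>. \<pi> i = s)"
  by (rule pred_eq_const1[OF measurable_coord]) simp

lemma emeasure_seqs_prefix:
  assumes "w \<in> words S s\<^sub>I"
  shows "emeasure seqs {\<pi>. \<forall>i<length w. \<pi> i = w ! i} = ennreal (word_prob T w)"
proof -
  obtain n where n: "length w = Suc n"
    using assms by (cases w) (auto simp: words_def)
  define f where "f = (\<lambda>i\<in>{0..<Suc n}. w ! i)"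
  have f: "f \<in> extensional {0..<Suc n}" by (simp add: f_def)
  have f0: "f 0 = s\<^sub>I" using assms n by (auto simp: f_def words_def hd_conv_nth)
  have "{\<pi>. \<forall>i<length w. \<pi> i = w ! i} = prod_emb UNIV (\<lambda>_. count_space UNIV) {0..<Suc n} {f}"
    by (auto simp: prod_emb_def f_def n fun_eq_iff space_PiM restrict_def) (metis)
  then have "emeasure seqs {\<pi>. \<forall>i<length w. \<pi> i = w ! i} = emeasure (IT.CI {0..<Suc n}) {f}"
    unfolding seqs_def using IT.lim[OF _ sets_single[OF f]] by simp
  also have "\<dots> = emeasure (IT.C 0 (Suc n) (\<lambda>_. undefined)) {f}"
    using IT.emeasure_CI[OF subset_refl sets_single[OF f]] sets.sets_into_space[OF sets_single[OF f]]
    by (simp del: IT.C.simps add: prod_emb_id space_PiM)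
  also have "\<dots> = ennreal (\<Prod>i<n. pmf (T (f i)) (f (Suc i)))"
    using f f0 by (rule emeasure_C_single)
  also have "(\<Prod>i<n. pmf (T (f i)) (f (Suc i))) = word_prob T w"
    unfolding word_prob_def by (intro prod.cong) (auto simp: f_def n)
  finally show ?thesis .
qed

lemma word_prob_nonneg: "0 \<le> word_prob T w"
  by (simp add: word_prob_def prod_nonneg)

lemma word_prob_snoc:
  "w \<noteq> [] \<Longrightarrow> word_prob T (w @ [s]) = word_prob T w * pmf (T (last w)) s"
  by (cases "length w") (auto simp: word_prob_def nth_append last_conv_nth)

lemma finite_words: "finite {w \<in> words S s\<^sub>I. length w = n}"
  by (rule finite_subset[OF _ finite_lists_length_eq[OF finite_S, of n]]) (auto simp: words_def)

lemma sum_word_prob: "(\<Sum>w | w \<in> words S s\<^sub>I \<and> length w = Suc n. word_prob T w) = 1"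
proof (induction n)
  case 0
  have "{w. w \<in> words S s\<^sub>I \<and> length w = Suc 0} = {[s\<^sub>I]}"
    using init_S by (auto simp: words_def length_Suc_conv)
  then show ?case by (simp add: word_prob_def)
next
  case (Suc n)
  let ?A = "{w. w \<in> words S s\<^sub>I \<and> length w = Suc n}"
  have eq: "{w. w \<in> words S s\<^sub>I \<and> length w = Suc (Suc n)} = (\<lambda>(w, s). w @ [s]) ` (?A \<times> S)"
  proof safe
    fix w assume w: "w \<in> words S s\<^sub>I" "length w = Suc (Suc n)"
    then have ne: "w \<noteq> []" "butlast w \<noteq> []"
      by (auto simp flip: length_greater_0_conv)
    have "w = (\<lambda>(w, s). w @ [s]) (butlast w, last w)"
      using ne by simp
    moreover have "hd (butlast w) = hd w"
      using ne by (metis append_butlast_last_id hd_append2)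
    ultimately show "w \<in> (\<lambda>(w, s). w @ [s]) ` (?A \<times> S)"
      using w ne by (intro image_eqI[of _ _ "(butlast w, last w)"])
        (auto simp: words_def dest: in_set_butlastD last_in_set)
  qed (auto simp: words_def)
  have "(\<Sum>w | w \<in> words S s\<^sub>I \<and> length w = Suc (Suc n). word_prob T w) =
      (\<Sum>(w, s)\<in>?A \<times> S. word_prob T (w @ [s]))"
    unfolding eq by (subst sum.reindex) (auto simp: inj_on_def case_prod_unfold)
  also have "\<dots> = (\<Sum>w\<in>?A. \<Sum>s\<in>S. word_prob T (w @ [s]))"
    by (simp add: sum.cartesian_product)
  also have "\<dots> = (\<Sum>w\<in>?A. word_prob T w)"
  proof (rule sum.cong[OF refl])
    fix w assume "w \<in> ?A"
    then have w: "w \<noteq> []" "last w \<in> S"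
      by (auto simp: words_def)
    have "(\<Sum>s\<in>S. pmf (T (last w)) s) = 1"
      using finite_S T_closed[OF w(2)] by (rule sum_pmf_eq_1)
    then show "(\<Sum>s\<in>S. word_prob T (w @ [s])) = word_prob T w"
      using w by (simp add: word_prob_snoc flip: sum_distrib_left)
  qed
  finally show ?case using Suc.IH by simp
qed

lemma sets_prefix: "{\<pi>. \<forall>i<n. \<pi> i = w ! i} \<in> sets seqs"
proof -
  have "{\<pi> \<in> space seqs. \<forall>i\<in>{..<n}. \<pi> i = w ! i} \<in> sets seqs"
    by measurable
  then show ?thesis by (simp add: Ball_def)
qed

lemma prob_space_seqs: "prob_space seqs"
proof
  let ?M = "Pi\<^sub>M {} (\<lambda>_. count_space (UNIV :: 's set))"
  interpret C: prob_space "IT.CI {}" by (rule IT.PF.prob_space_P) auto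
  have top: "space ?M \<in> sets ?M" by (rule sets.top)
  have "emeasure seqs UNIV = emeasure (IT.CI {}) (space ?M)"
    using IT.lim[OF finite.emptyI top]
    by (simp add: seqs_def prod_emb_def space_PiM restrict_def)
  also have "space ?M = space (IT.CI {})"
    by (simp add: IT.CI_def)
  also have "emeasure (IT.CI {}) \<dots> = 1"
    by (rule C.emeasure_space_1)
  finally show "emeasure seqs (space seqs) = 1" by simp
qed

lemma AE_prefix:
  "AE \<pi> in seqs. \<exists>w\<in>words S s\<^sub>I. length w = Suc n \<and> word_prob T w > 0 \<and> (\<forall>i<Suc n. \<pi> i = w ! i)"
proof -
  interpret seqs: prob_space seqs by (rule prob_space_seqs)
  let ?A = "{w \<in> words S s\<^sub>I. length w = Suc n}"
  let ?P = "{w \<in> ?A. word_prob T w > 0}"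
  let ?D = "\<lambda>w. {\<pi>. \<forall>i<Suc n. \<pi> i = w ! i}"
  have fin: "finite ?P" using finite_words[of "Suc n"] by (rule rev_finite_subset) auto
  have disj: "disjoint_family_on ?D ?P"
    unfolding disjoint_family_on_def
  proof (intro ballI impI)
    fix v w assume vw: "v \<in> ?P" "w \<in> ?P" "v \<noteq> w"
    show "?D v \<inter> ?D w = {}"
    proof (rule ccontr)
      assume "?D v \<inter> ?D w \<noteq> {}"
      then obtain \<pi> where \<pi>: "\<forall>i<Suc n. \<pi> i = v ! i" "\<forall>i<Suc n. \<pi> i = w ! i" by blast
      have "v = w" using vw \<pi> by (intro nth_equalityI) auto
      with vw show False by simp
    qed
  qed
  have "emeasure seqs (\<Union>w\<in>?P. ?D w) = (\<Sum>w\<in>?P. emeasure seqs (?D w))"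
    using fin disj sets_prefix by (intro sum_emeasure[symmetric]) auto
  also have "\<dots> = (\<Sum>w\<in>?P. ennreal (word_prob T w))"
  proof (rule sum.cong[OF refl])
    fix w assume "w \<in> ?P"
    then show "emeasure seqs (?D w) = ennreal (word_prob T w)"
      using emeasure_seqs_prefix[of w] by simp
  qed
  also have "\<dots> = ennreal (\<Sum>w\<in>?P. word_prob T w)"
    by (rule sum_ennreal) (rule word_prob_nonneg)
  also have "(\<Sum>w\<in>?P. word_prob T w) = (\<Sum>w\<in>?A. word_prob T w)"
    using finite_words[of "Suc n"] word_prob_nonneg
    by (intro sum.mono_neutral_left) (auto simp: less_le)
  also have "\<dots> = 1" by (rule sum_word_prob)
  finally have "AE \<pi> in seqs. \<pi> \<in> (\<Union>w\<in>?P. ?D w)"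
    using fin sets_prefix by (subst seqs.AE_in_set_eq_1) (auto simp: measure_def)
  then show ?thesis by eventually_elim auto
qed

lemma AE_paths: "AE \<pi> in seqs. \<pi> \<in> paths S T s\<^sub>I"
proof -
  have "AE \<pi> in seqs. \<forall>n. \<exists>w\<in>words S s\<^sub>I. length w = Suc n \<and> word_prob T w > 0 \<and> (\<forall>i<Suc n. \<pi> i = w ! i)"
    using AE_prefix by (simp add: AE_all_countable)
  then show ?thesis
  proof eventually_elim
    case (elim \<pi>)
    have "\<pi> i \<in> S \<and> \<pi> 0 = s\<^sub>I \<and> 0 < pmf (T (\<pi> i)) (\<pi> (Suc i))" for i
    proof -
      obtain w where w: "w \<in> words S s\<^sub>I" "length w = Suc (Suc i)" "word_prob T w > 0"
          and eq: "\<forall>j<Suc (Suc i). \<pi> j = w ! j"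
        using elim by blast
      have "\<pi> i = w ! i" "\<pi> (Suc i) = w ! Suc i" "\<pi> 0 = w ! 0"
        using eq by auto
      moreover have "w ! i \<in> S"
        using w by (auto simp: words_def dest!: nth_mem[of i w, OF _])
      moreover have "w ! 0 = s\<^sub>I"
        using w by (auto simp: words_def hd_conv_nth)
      moreover have "pmf (T (w ! i)) (w ! Suc i) \<noteq> 0"
        using w(2,3) by (auto simp: word_prob_def)
      ultimately show ?thesis by (simp add: less_le)
    qed
    then show ?case by (simp add: paths_def)
  qed
qed

lemma sets_paths: "paths S T s\<^sub>I \<in> sets seqs"
proof -
  let ?E = "{(s, s') \<in> S \<times> S. 0 < pmf (T s) s'}"
  have "finite ?E" using finite_S by (auto intro: finite_subset[of _ "S \<times> S"])
  then have "{\<pi> \<in> space seqs. \<pi> 0 = s\<^sub>I \<and> (\<forall>i. \<exists>e\<in>?E. \<pi> i = fst e \<and> \<pi> (Suc i) = snd e)} \<in> sets seqs"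
    by measurable
  also have "{\<pi> \<in> space seqs. \<pi> 0 = s\<^sub>I \<and> (\<forall>i. \<exists>e\<in>?E. \<pi> i = fst e \<and> \<pi> (Suc i) = snd e)} =
      paths S T s\<^sub>I"
    by (fastforce simp: paths_def)
  finally show ?thesis .
qed

lemma cylinder_eq: "cylinder S T s\<^sub>I w = {\<pi>. \<forall>i<length w. \<pi> i = w ! i} \<inter> paths S T s\<^sub>I"
  by (auto simp: cylinder_def)

lemma sets_cylinder_seqs: "cylinder S T s\<^sub>I w \<in> sets seqs"
  unfolding cylinder_eq using sets_prefix sets_paths by (rule sets.Int)

theorem emeasure_cylinder:
  assumes w: "w \<in> words S s\<^sub>I"
  shows "emeasure (path_measure S T s\<^sub>I) (cylinder S T s\<^sub>I w) = ennreal (word_prob T w)"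
proof (rule emeasure_extend_measure[OF path_measure_def, where \<mu>' = "emeasure seqs"])
  fix v assume v: "v \<in> words S s\<^sub>I"
  have "AE \<pi> in seqs. \<pi> \<in> cylinder S T s\<^sub>I v \<longleftrightarrow> \<pi> \<in> {\<pi>. \<forall>i<length v. \<pi> i = v ! i}"
    using AE_paths by eventually_elim (simp add: cylinder_eq)
  then have "emeasure seqs (cylinder S T s\<^sub>I v) = emeasure seqs {\<pi>. \<forall>i<length v. \<pi> i = v ! i}"
    using sets_cylinder_seqs sets_prefix by (rule emeasure_eq_AE)
  then show "emeasure seqs (cylinder S T s\<^sub>I v) = ennreal (word_prob T v)"
    using emeasure_seqs_prefix[OF v] by simp
next
  show "cylinder S T s\<^sub>I ` words S s\<^sub>I \<subseteq> Pow (paths S T s\<^sub>I)"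
    by (auto simp: cylinder_def)
  have "sigma_sets (paths S T s\<^sub>I) (cylinder S T s\<^sub>I ` words S s\<^sub>I) \<subseteq> sets seqs"
    using sets_paths sets_cylinder_seqs by (intro sets.sigma_sets_subset') auto
  then have sub: "sets (path_measure S T s\<^sub>I) \<subseteq> sets seqs"
    by (simp add: sets_path_measure)
  show "positive (sets (path_measure S T s\<^sub>I)) (emeasure seqs)"
    by (simp add: positive_def)
  show "countably_additive (sets (path_measure S T s\<^sub>I)) (emeasure seqs)"
    using sub by (auto simp: countably_additive_def intro!: suminf_emeasure)
qed (use w in auto)

theorem prob_space_path_measure: "prob_space (path_measure S T s\<^sub>I)"
proof
  have "paths S T s\<^sub>I = cylinder S T s\<^sub>I [s\<^sub>I]"
    by (auto simp: cylinder_def paths_def)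
  moreover have "[s\<^sub>I] \<in> words S s\<^sub>I"
    using init_S by (simp add: words_def)
  ultimately show "emeasure (path_measure S T s\<^sub>I) (space (path_measure S T s\<^sub>I)) = 1"
    using emeasure_cylinder[of "[s\<^sub>I]"] by (simp add: word_prob_def)
qed

theorem path_measure_unique:
  assumes sets: "sets M = sigma_sets (paths S T s\<^sub>I) (cylinder S T s\<^sub>I ` words S s\<^sub>I)"
    and eq: "\<And>w. w \<in> words S s\<^sub>I \<Longrightarrow> emeasure M (cylinder S T s\<^sub>I w) = ennreal (word_prob T w)"
  shows "M = path_measure S T s\<^sub>I"
proof -
  let ?E = "insert {} (cylinder S T s\<^sub>I ` words S s\<^sub>I)"
  have Int: "cylinder S T s\<^sub>I v \<inter> cylinder S T s\<^sub>I w \<in> ?E"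
    if "v \<in> words S s\<^sub>I" "w \<in> words S s\<^sub>I" "length v \<le> length w" for v w
  proof (cases "\<forall>i<length v. v ! i = w ! i")
    case True
    then have "cylinder S T s\<^sub>I v \<inter> cylinder S T s\<^sub>I w = cylinder S T s\<^sub>I w"
      using that(3) by (auto simp: cylinder_def)
    then show ?thesis using that(2) by simp
  next
    case False
    then have "cylinder S T s\<^sub>I v \<inter> cylinder S T s\<^sub>I w = {}"
      using that(3) by (auto simp: cylinder_def)
    then show ?thesis by simp
  qed
  have "Int_stable ?E"
  proof (rule Int_stableI)
    fix a b assume "a \<in> ?E" "b \<in> ?E"
    then consider "a = {} \<or> b = {}"
      | v w where "v \<in> words S s\<^sub>I" "w \<in> words S s\<^sub>I" "a = cylinder S T s\<^sub>I v" "b = cylinder S T s\<^sub>I w"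
      by blast
    then show "a \<inter> b \<in> ?E"
    proof cases
      case 2
      then show ?thesis
        using Int[of v w] Int[of w v] by (metis Int_commute nle_le)
    qed auto
  qed
  moreover have "?E \<subseteq> Pow (paths S T s\<^sub>I)"
    by (auto simp: cylinder_def)
  moreover have sigma: "sigma_sets (paths S T s\<^sub>I) (cylinder S T s\<^sub>I ` words S s\<^sub>I) = sigma_sets (paths S T s\<^sub>I) ?E"
    by (intro antisym sigma_sets_mono) (auto intro: sigma_sets.intros)
  moreover have top: "cylinder S T s\<^sub>I [s\<^sub>I] = paths S T s\<^sub>I" "[s\<^sub>I] \<in> words S s\<^sub>I"
    using init_S by (auto simp: cylinder_def paths_def words_def)
  ultimately show ?thesis
    using sets eq emeasure_cylinder eq[OF top(2)]
    by (intro measure_eqI_generator_eq[where E = ?E and \<Omega> = "paths S T s\<^sub>I" and A = "\<lambda>_. paths S T s\<^sub>I"])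
      (auto simp: sets_path_measure intro: image_eqI[of _ _ "[s\<^sub>I]"])
qed

end

end

(*
  After j steps outside G, every state that can be reached can reach G in at most |S| - 1 further
  steps, since otherwise G would be missed with positive probability. Hence the probability t j of
  avoiding G in the states 0..j satisfies t (j + N - 1) \<le> (1 - p^(N-1)) t j. Summing the rewards
  position by position bounds the tail by r ((q N + 1) t (q N) + sum of t k over k \<ge> q N), and
  therefore by r N (1 - p^N)^q (q p^N + 1) / p^N: the gain from using N - 1 instead of N pays for
  the reward of position 0. The factor in the theorem is q (1 - p^N) + 1 instead, which is no
  smaller if p^N \<le> 1/2. Otherwise p > 1/2, so that all transitions are deterministic and the
  bound can be applied with 1 for p.
*)

theory Submission
  imports Defs
begin

section \<open>Probabilities of avoiding \<open>G\<close> for finitely many steps\<close>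

text \<open>Recursion on the first step treats every start state by finite sums, whereas the path
  measure at hand starts in \<open>s\<^sub>I\<close> only. Horizon \<open>m\<close> covers the
  \<open>m + 1\<close> states at times 0 to \<open>m\<close>.\<close>

primrec avoid_prob :: "'s set \<Rightarrow> ('s \<Rightarrow> 's pmf) \<Rightarrow> 's set \<Rightarrow> nat \<Rightarrow> 's \<Rightarrow> real" where
  "avoid_prob S T G 0 s = (if s \<in> G then 0 else 1)"
| "avoid_prob S T G (Suc m) s =
     (if s \<in> G then 0 else \<Sum>s'\<in>S. pmf (T s) s' * avoid_prob S T G m s')"

definition avoiding_words :: "'s set \<Rightarrow> 's \<Rightarrow> 's set \<Rightarrow> nat \<Rightarrow> 's list set" where
  "avoiding_words S s\<^sub>I G j = {w \<in> words S s\<^sub>I. length w = Suc j \<and> set w \<inter> G = {}}"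

text \<open>This is the \<open>t j\<close> of the proof idea. \<open>emeasure_less_idx\<close>
  identifies it with the measure of the paths whose first visit to \<open>G\<close>, if any, comes
  after time \<open>j\<close>.\<close>

definition avoid_mass :: "'s set \<Rightarrow> ('s \<Rightarrow> 's pmf) \<Rightarrow> 's \<Rightarrow> 's set \<Rightarrow> nat \<Rightarrow> real" where
  "avoid_mass S T s\<^sub>I G j = (\<Sum>w\<in>avoiding_words S s\<^sub>I G j. word_prob T w)"

section \<open>First visits, decaying sequences and concentrated distributions\<close>

lemma enat_le_idx_iff: "enat i \<le> idx \<pi> G \<longleftrightarrow> (\<forall>k<i. \<pi> k \<notin> G)"
  unfolding idx_def le_INF_iff by (auto simp: not_less[symmetric])

lemma enat_less_idx_iff: "enat i < idx \<pi> G \<longleftrightarrow> (\<forall>k\<le>i. \<pi> k \<notin> G)"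
  using enat_le_idx_iff[of "Suc i" \<pi> G] by (simp add: less_Suc_eq_le Suc_ile_eq)

lemma decay_partial_sum_le:
  fixes t :: "nat \<Rightarrow> real"
  assumes anti: "antimono t" and nonneg: "\<And>j. 0 \<le> t j"
    and decay: "\<And>j. t (j + m) \<le> (1 - c) * t j"
  shows "c * (\<Sum>k<K. t (j + k)) \<le> real m * t j"
proof -
  have "(\<Sum>k<K. t (j + k)) \<le> (\<Sum>k<m + K. t (j + k))"
    by (rule sum_mono2) (auto simp: nonneg)
  also have "\<dots> = (\<Sum>k<m. t (j + k)) + (\<Sum>k<K. t (j + k + m))"
    by (induction K) (auto simp: algebra_simps)
  also have "\<dots> \<le> (\<Sum>k<m. t j) + (\<Sum>k<K. (1 - c) * t (j + k))"
    by (intro add_mono sum_mono decay antimonoD[OF anti]) auto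
  also have "\<dots> = real m * t j + (1 - c) * (\<Sum>k<K. t (j + k))"
    by (simp add: sum_distrib_left)
  finally show ?thesis
    by (simp add: algebra_simps)
qed

lemma decay_power_le:
  fixes t :: "nat \<Rightarrow> real"
  assumes "\<And>j. t (j + m) \<le> c * t j" "0 \<le> c" "t 0 \<le> 1"
  shows "t (q * m) \<le> c ^ q"
proof (induction q)
  case (Suc q)
  have "t (Suc q * m) \<le> c * t (q * m)"
    using assms(1)[of "q * m"] by (simp add: add.commute)
  also have "\<dots> \<le> c * c ^ q"
    using Suc assms(2) by (intro mult_left_mono)
  finally show ?case by simp
qed (use assms in simp)

text \<open>Two distinct outcomes, each of probability above 1/2, would exceed total mass 1. This
  makes the chain deterministic when \<open>p\<close> is above 1/2.\<close>

lemma pmf_eq_1_if_all_gt_half: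
  assumes "\<And>y. pmf M y \<noteq> 0 \<Longrightarrow> 1 / 2 < pmf M y" "pmf M x \<noteq> 0"
  shows "pmf M x = 1"
proof -
  have "y = x" if "y \<in> set_pmf M" for y
  proof (rule ccontr)
    assume "y \<noteq> x"
    then have "pmf M x + pmf M y = measure M {x, y}"
      by (simp add: measure_measure_pmf_finite)
    moreover have "measure M {x, y} \<le> 1" by simp
    moreover have "1 / 2 < pmf M x" "1 / 2 < pmf M y"
      using assms that by (auto simp: set_pmf_iff)
    ultimately show False by linarith
  qed
  then have "set_pmf M \<subseteq> {x}" by blast
  then have "M = return_pmf x" by (simp only: set_pmf_subset_singleton)
  then show ?thesis by simp
qed

context dtmc
begin

section \<open>Avoiding \<open>G\<close> from a given state\<close>

lemma sum_pmf_T: "s \<in> S \<Longrightarrow> (\<Sum>s'\<in>S. pmf (T s) s') = 1"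
  using finite_S T_closed by (rule sum_pmf_eq_1)

lemma avoid_prob_bounds: "s \<in> S \<Longrightarrow> 0 \<le> avoid_prob S T G m s \<and> avoid_prob S T G m s \<le> 1"
proof (induction m arbitrary: s)
  case (Suc m)
  have "(\<Sum>s'\<in>S. pmf (T s) s' * avoid_prob S T G m s') \<le> (\<Sum>s'\<in>S. pmf (T s) s' * 1)"
    using Suc.IH by (intro sum_mono mult_left_mono) auto
  moreover have "0 \<le> (\<Sum>s'\<in>S. pmf (T s) s' * avoid_prob S T G m s')"
    using Suc.IH by (intro sum_nonneg mult_nonneg_nonneg) auto
  ultimately show ?case using sum_pmf_T[OF Suc.prems] by simp
qed simp

lemma avoid_prob_Suc_le: "s \<in> S \<Longrightarrow> avoid_prob S T G (Suc m) s \<le> avoid_prob S T G m s"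
proof (induction m arbitrary: s)
  case 0
  then show ?case using avoid_prob_bounds[of s G "Suc 0"] by auto
next
  case (Suc m)
  have "(\<Sum>s'\<in>S. pmf (T s) s' * avoid_prob S T G (Suc m) s')
      \<le> (\<Sum>s'\<in>S. pmf (T s) s' * avoid_prob S T G m s')"
    using Suc.IH by (intro sum_mono mult_left_mono) auto
  then show ?case by simp
qed

lemma avoid_prob_antimono:
  assumes "s \<in> S" "m \<le> n"
  shows "avoid_prob S T G n s \<le> avoid_prob S T G m s"
  using assms(2)
proof (induction n rule: dec_induct)
  case (step n)
  then show ?case using avoid_prob_Suc_le[OF assms(1), of G n] by linarith
qed simp

text \<open>Outside \<open>G\<close>, \<open>1 - avoid_prob\<close> is a sum over successors of
  hitting probabilities; the route through \<open>s'\<close> is one of its nonnegative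
  summands.\<close>

lemma avoid_prob_Suc_le_successor:
  assumes "s \<in> S" "s' \<in> S"
  shows "avoid_prob S T G (Suc m) s \<le> 1 - pmf (T s) s' * (1 - avoid_prob S T G m s')"
proof (cases "s \<in> G")
  case True
  have "pmf (T s) s' * (1 - avoid_prob S T G m s') \<le> 1 * 1"
    using avoid_prob_bounds[OF assms(2)] by (intro mult_mono) (auto simp: pmf_le_1)
  with True show ?thesis by simp
next
  case False
  have "pmf (T s) s' * (1 - avoid_prob S T G m s')
      \<le> (\<Sum>x\<in>S. pmf (T s) x * (1 - avoid_prob S T G m x))"
    using assms finite_S avoid_prob_bounds
    by (intro member_le_sum[of s' S "\<lambda>x. pmf (T s) x * (1 - avoid_prob S T G m x)"]) auto
  also have "\<dots> = 1 - avoid_prob S T G (Suc m) s"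
    using False sum_pmf_T[OF assms(1)] by (simp add: right_diff_distrib sum_subtractf)
  finally show ?thesis by simp
qed

text \<open>If every possible successor avoided \<open>G\<close> with probability 1, the first-step
  sum would be the total mass of \<open>T s\<close>.\<close>

lemma avoid_prob_Suc_less_1_successor:
  assumes "s \<in> S" "s \<notin> G" "avoid_prob S T G (Suc m) s < 1"
  shows "\<exists>s'\<in>S. pmf (T s) s' \<noteq> 0 \<and> avoid_prob S T G m s' < 1"
proof (rule ccontr)
  assume *: "\<not> ?thesis"
  have "pmf (T s) s' * avoid_prob S T G m s' = pmf (T s) s'" if "s' \<in> S" for s'
  proof (cases "pmf (T s) s' = 0")
    case False
    then have "avoid_prob S T G m s' = 1"
      using * that avoid_prob_bounds[OF that, of G m] by force
    then show ?thesis by simp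
  qed simp
  then have "(\<Sum>s'\<in>S. pmf (T s) s' * avoid_prob S T G m s') = (\<Sum>s'\<in>S. pmf (T s) s')"
    by (rule sum.cong[OF refl])
  then have "avoid_prob S T G (Suc m) s = 1"
    using assms(2) sum_pmf_T[OF assms(1)] by simp
  with assms(3) show False by simp
qed

text \<open>If \<open>G\<close> can be hit within \<open>m\<close> steps at all, some route does so
  with at most \<open>m\<close> transitions, each of probability at least \<open>p\<close>. The
  induction follows such a route; \<open>p \<le> 1\<close> covers routes that end early.\<close>

lemma avoid_prob_le:
  assumes p: "0 < p" "\<And>s s'. s \<in> S \<Longrightarrow> s' \<in> S \<Longrightarrow> pmf (T s) s' \<noteq> 0 \<Longrightarrow> p \<le> pmf (T s) s'"
    and "p \<le> 1"
  shows "s \<in> S \<Longrightarrow> avoid_prob S T G m s < 1 \<Longrightarrow> avoid_prob S T G m s \<le> 1 - p ^ m"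
proof (induction m arbitrary: s)
  case (Suc m)
  show ?case
  proof (cases "s \<in> G")
    case True
    then show ?thesis using power_le_one[of p "Suc m"] assms by simp
  next
    case False
    then obtain s' where s': "s' \<in> S" "pmf (T s) s' \<noteq> 0" "avoid_prob S T G m s' < 1"
      using avoid_prob_Suc_less_1_successor[OF Suc.prems(1) False Suc.prems(2)] by blast
    have "avoid_prob S T G (Suc m) s \<le> 1 - pmf (T s) s' * (1 - avoid_prob S T G m s')"
      using Suc.prems s' by (intro avoid_prob_Suc_le_successor)
    also have "\<dots> \<le> 1 - p * p ^ m"
      using Suc.IH[OF s'(1,3)] p(2)[OF Suc.prems(1) s'(1,2)] p(1)
      by (intro diff_left_mono mult_mono) auto
    finally show ?thesis by simp
  qed
qed (auto split: if_splits)

text \<open>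
  The least number of steps to \<open>G\<close> takes every value between \<open>0\<close> and its value at \<open>s\<close>, as one
  sees by moving along a shortest path; hence that value is smaller than \<open>card S\<close>.
\<close>

lemma avoid_prob_card_less_1:
  assumes s: "s \<in> S" and hit: "avoid_prob S T G m s < 1" and N: "card S \<le> Suc n"
  shows "avoid_prob S T G n s < 1"
proof -
  define d where "d x = (LEAST m. avoid_prob S T G m x < 1)" for x
  have d: "avoid_prob S T G (d x) x < 1" if "avoid_prob S T G k x < 1" for x k
    unfolding d_def using that by (rule LeastI)
  have d_le: "d x \<le> k" if "avoid_prob S T G k x < 1" for x k
    unfolding d_def using that by (rule Least_le)
  have onto: "{..k} \<subseteq> d ` S" if "x \<in> S" "avoid_prob S T G k x < 1" "d x = k" for x k
    using that
  proof (induction k arbitrary: x)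
    case (Suc k)
    have "x \<notin> G" using d_le[of 0 x] Suc.prems by auto
    then obtain x' where x': "x' \<in> S" "pmf (T x) x' \<noteq> 0" "avoid_prob S T G k x' < 1"
      using avoid_prob_Suc_less_1_successor[OF Suc.prems(1) _ Suc.prems(2)] by blast
    \<comment> \<open>Going through \<open>x'\<close> gives \<open>d x \<le> Suc (d x')\<close>.
      Since \<open>d x = Suc k\<close> and \<open>d x' \<le> k\<close>, this forces
      \<open>d x' = k\<close>.\<close>
    have "0 < pmf (T x) x' * (1 - avoid_prob S T G (d x') x')"
      using x' d[OF x'(3)] by (intro mult_pos_pos) (auto simp: less_le)
    then have "avoid_prob S T G (Suc (d x')) x < 1"
      using avoid_prob_Suc_le_successor[OF Suc.prems(1) x'(1), of G "d x'"] by linarith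
    from d_le[OF this] d_le[OF x'(3)] have "d x' = k" using Suc.prems by simp
    from Suc.IH[OF x'(1,3) this] have "{..k} \<subseteq> d ` S" .
    moreover have "Suc k \<in> d ` S" using Suc.prems(1,3) by (metis imageI)
    ultimately show ?case by (simp add: atMost_Suc)
  qed auto
  have "{..d s} \<subseteq> d ` S" using s d[OF hit] by (intro onto) auto
  then have "card {..d s} \<le> card (d ` S)"
    using finite_S by (intro card_mono) auto
  also have "\<dots> \<le> Suc n" using card_image_le[OF finite_S, of d] N by linarith
  finally show ?thesis
    using avoid_prob_antimono[OF s, of "d s" n G] d[OF hit] by simp
qed

section \<open>Total probability of the words avoiding \<open>G\<close>\<close>

lemma finite_avoiding_words: "finite (avoiding_words S s\<^sub>I G j)"
  using finite_words[of "Suc j"] by (rule rev_finite_subset) (auto simp: avoiding_words_def)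

lemma last_avoiding_words: "w \<in> avoiding_words S s\<^sub>I G j \<Longrightarrow> last w \<in> S - G"
  by (cases w rule: rev_cases) (auto simp: avoiding_words_def words_def)

lemma avoiding_words_Suc:
  "avoiding_words S s\<^sub>I G (Suc j) = (\<lambda>(w, s). w @ [s]) ` (avoiding_words S s\<^sub>I G j \<times> (S - G))"
proof safe
  fix w assume w: "w \<in> avoiding_words S s\<^sub>I G (Suc j)"
  then obtain v s where v: "w = v @ [s]"
    by (cases w rule: rev_cases) (auto simp: avoiding_words_def)
  with w have "v \<noteq> []" by (auto simp: avoiding_words_def)
  with w v show "w \<in> (\<lambda>(w, s). w @ [s]) ` (avoiding_words S s\<^sub>I G j \<times> (S - G))"
    by (intro image_eqI[of _ _ "(v, s)"]) (auto simp: avoiding_words_def words_def)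
qed (auto simp: avoiding_words_def words_def)

text \<open>The Markov property at time \<open>j\<close>: the future depends on an avoiding prefix
  only through its last state. The induction hands one step at a time from \<open>avoid_prob\<close>
  to the words, reading \<open>j + Suc m\<close> as \<open>Suc j + m\<close>.\<close>

lemma avoid_mass_add:
  "avoid_mass S T s\<^sub>I G (j + m) =
     (\<Sum>w\<in>avoiding_words S s\<^sub>I G j. word_prob T w * avoid_prob S T G m (last w))"
proof (induction m arbitrary: j)
  case 0
  show ?case unfolding avoid_mass_def
    by (auto intro!: sum.cong dest: last_avoiding_words)
next
  case (Suc m)
  let ?W = "avoiding_words S s\<^sub>I G" and ?u = "avoid_prob S T G"
  \<comment> \<open>Vanishing on \<open>G\<close> reconciles the sum over \<open>S\<close> in the
    recursion with the sum over \<open>S - G\<close> that extends avoiding words.\<close>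
  have G: "?u m s = 0" if "s \<in> G" for s using that by (cases m) auto
  have "avoid_mass S T s\<^sub>I G (j + Suc m) = avoid_mass S T s\<^sub>I G (Suc j + m)" by simp
  also have "\<dots> = (\<Sum>w\<in>?W (Suc j). word_prob T w * ?u m (last w))" by (rule Suc.IH)
  also have "\<dots> = (\<Sum>(w, s)\<in>?W j \<times> (S - G). word_prob T (w @ [s]) * ?u m s)"
    unfolding avoiding_words_Suc by (subst sum.reindex) (auto simp: inj_on_def case_prod_unfold)
  also have "\<dots> = (\<Sum>w\<in>?W j. \<Sum>s\<in>S - G. word_prob T (w @ [s]) * ?u m s)"
    by (simp add: sum.cartesian_product)
  also have "\<dots> = (\<Sum>w\<in>?W j. word_prob T w * ?u (Suc m) (last w))"
  proof (rule sum.cong[OF refl])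
    fix w assume w: "w \<in> ?W j"
    then have ne: "w \<noteq> []" by (auto simp: avoiding_words_def words_def)
    have "(\<Sum>s\<in>S - G. word_prob T (w @ [s]) * ?u m s) =
        word_prob T w * (\<Sum>s\<in>S - G. pmf (T (last w)) s * ?u m s)"
      by (simp add: word_prob_snoc[OF ne] sum_distrib_left mult.assoc)
    also have "(\<Sum>s\<in>S - G. pmf (T (last w)) s * ?u m s) = (\<Sum>s\<in>S. pmf (T (last w)) s * ?u m s)"
      using finite_S G by (intro sum.mono_neutral_left) auto
    finally show "(\<Sum>s\<in>S - G. word_prob T (w @ [s]) * ?u m s) = word_prob T w * ?u (Suc m) (last w)"
      using last_avoiding_words[OF w] by simp
  qed
  finally show ?case .
qed

lemma avoid_mass_nonneg: "0 \<le> avoid_mass S T s\<^sub>I G j"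
  unfolding avoid_mass_def by (intro sum_nonneg word_prob_nonneg)

lemma avoid_mass_antimono: "antimono (avoid_mass S T s\<^sub>I G)"
proof (rule antimonoI)
  fix i j :: nat assume "i \<le> j"
  then obtain k where j: "j = i + k" by (auto simp: le_iff_add)
  show "avoid_mass S T s\<^sub>I G j \<le> avoid_mass S T s\<^sub>I G i"
    unfolding j avoid_mass_add unfolding avoid_mass_def
    using avoid_prob_bounds last_avoiding_words word_prob_nonneg
    by (intro sum_mono mult_left_le) blast+
qed

lemma avoid_mass_le_1: "avoid_mass S T s\<^sub>I G j \<le> 1"
proof -
  have "avoid_mass S T s\<^sub>I G j \<le> (\<Sum>w | w \<in> words S s\<^sub>I \<and> length w = Suc j. word_prob T w)"
    unfolding avoid_mass_def using finite_words
    by (intro sum_mono2) (auto simp: avoiding_words_def word_prob_nonneg)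
  then show ?thesis by (simp add: sum_word_prob)
qed

text \<open>From the last state of any avoiding word of positive probability, \<open>G\<close> must
  be reachable, or the mass of that word would persist forever. Reachability within
  \<open>card S - 1\<close> steps, hence within \<open>n\<close>, then costs each word at least the
  fraction \<open>p ^ n\<close>.\<close>

lemma avoid_mass_decay:
  assumes p: "0 < p" "\<And>s s'. s \<in> S \<Longrightarrow> s' \<in> S \<Longrightarrow> pmf (T s) s' \<noteq> 0 \<Longrightarrow> p \<le> pmf (T s) s'"
    and "p \<le> 1" and lim: "avoid_mass S T s\<^sub>I G \<longlonglongrightarrow> 0" and N: "card S \<le> Suc n"
  shows "avoid_mass S T s\<^sub>I G (j + n) \<le> (1 - p ^ n) * avoid_mass S T s\<^sub>I G j"
proof -
  have "word_prob T w * avoid_prob S T G n (last w) \<le> (1 - p ^ n) * word_prob T w"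
    if w: "w \<in> avoiding_words S s\<^sub>I G j" for w
  proof (cases "word_prob T w = 0")
    case False
    then have pos: "0 < word_prob T w" using word_prob_nonneg[of w] by simp
    have s: "last w \<in> S" using last_avoiding_words[OF w] by simp
    \<comment> \<open>Choose \<open>m\<close> so late that all avoiding words together weigh less
      than \<open>w\<close> alone does; then the extensions of \<open>w\<close> cannot all avoid
      \<open>G\<close>.\<close>
    have "(\<lambda>m. avoid_mass S T s\<^sub>I G (j + m)) \<longlonglongrightarrow> 0"
      using LIMSEQ_ignore_initial_segment[OF lim, of j] by (simp add: add.commute)
    then have "\<forall>\<^sub>F m in sequentially. avoid_mass S T s\<^sub>I G (j + m) < word_prob T w"
      using pos by (rule order_tendstoD)
    then obtain m where m: "avoid_mass S T s\<^sub>I G (j + m) < word_prob T w"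
      by (auto simp: eventually_sequentially)
    have "word_prob T w * avoid_prob S T G m (last w) \<le> avoid_mass S T s\<^sub>I G (j + m)"
      unfolding avoid_mass_add using w finite_avoiding_words
      by (intro member_le_sum[of w _ "\<lambda>w. word_prob T w * avoid_prob S T G m (last w)"])
        (use avoid_prob_bounds last_avoiding_words word_prob_nonneg in \<open>auto intro!: mult_nonneg_nonneg\<close>)
    with m have "word_prob T w * avoid_prob S T G m (last w) < word_prob T w * 1" by simp
    then have "avoid_prob S T G m (last w) < 1"
      using pos by (subst (asm) mult_less_cancel_left_pos)
    then have "avoid_prob S T G n (last w) < 1"
      by (rule avoid_prob_card_less_1[OF s _ N])
    then have "avoid_prob S T G n (last w) \<le> 1 - p ^ n"
      using p \<open>p \<le> 1\<close> s by (intro avoid_prob_le)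
    with pos show ?thesis by (simp add: mult.commute)
  qed simp
  then have "avoid_mass S T s\<^sub>I G (j + n) \<le>
      (\<Sum>w\<in>avoiding_words S s\<^sub>I G j. (1 - p ^ n) * word_prob T w)"
    unfolding avoid_mass_add by (intro sum_mono)
  then show ?thesis by (simp add: avoid_mass_def sum_distrib_left)
qed

section \<open>Events on paths that are determined by finitely many states\<close>

text \<open>Finiteness of \<open>S\<close> leaves finitely many prefixes, so measurability and
  probability of prefix events reduce to cylinders.\<close>

lemma path_prefix_eq_UN:
  "{\<pi> \<in> paths S T s\<^sub>I. Q (map \<pi> [0..<Suc j])} =
     (\<Union>w\<in>{w \<in> words S s\<^sub>I. length w = Suc j \<and> Q w}. cylinder S T s\<^sub>I w)"
proof safe
  fix \<pi> assume \<pi>: "\<pi> \<in> paths S T s\<^sub>I" "Q (map \<pi> [0..<Suc j])"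
  have "hd (map \<pi> [0..<Suc j]) = s\<^sub>I"
    using \<pi> by (subst hd_map) (auto simp: paths_def simp del: upt_Suc)
  then have "map \<pi> [0..<Suc j] \<in> words S s\<^sub>I"
    using \<pi> by (auto simp: paths_def words_def simp del: upt_Suc)
  moreover have "\<pi> \<in> cylinder S T s\<^sub>I (map \<pi> [0..<Suc j])"
    using \<pi> by (auto simp: cylinder_def simp del: upt_Suc)
  ultimately show "\<pi> \<in> (\<Union>w\<in>{w \<in> words S s\<^sub>I. length w = Suc j \<and> Q w}. cylinder S T s\<^sub>I w)"
    using \<pi> by (intro UN_I[of "map \<pi> [0..<Suc j]"]) (auto simp del: upt_Suc)
next
  fix \<pi> w assume *: "length w = Suc j" "Q w" "\<pi> \<in> cylinder S T s\<^sub>I w"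
  then have "map \<pi> [0..<Suc j] = w"
    by (intro nth_equalityI) (auto simp: cylinder_def simp del: upt_Suc)
  with * show "Q (map \<pi> [0..<Suc j])" by simp
qed (auto simp: cylinder_def)

lemma sets_path_prefix:
  "{\<pi> \<in> paths S T s\<^sub>I. Q (map \<pi> [0..<Suc j])} \<in> sets (path_measure S T s\<^sub>I)"
  unfolding path_prefix_eq_UN using finite_words[of "Suc j"]
  by (intro sets.finite_UN) (auto simp: sets_path_measure intro: rev_finite_subset)

lemma emeasure_path_prefix:
  "emeasure (path_measure S T s\<^sub>I) {\<pi> \<in> paths S T s\<^sub>I. Q (map \<pi> [0..<Suc j])} =
     ennreal (\<Sum>w | w \<in> words S s\<^sub>I \<and> length w = Suc j \<and> Q w. word_prob T w)"
proof -
  let ?W = "{w \<in> words S s\<^sub>I. length w = Suc j \<and> Q w}"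
  have "disjoint_family_on (cylinder S T s\<^sub>I) ?W"
    unfolding disjoint_family_on_def
  proof (intro ballI impI equals0I)
    fix v w \<pi> assume *: "v \<in> ?W" "w \<in> ?W" "v \<noteq> w" "\<pi> \<in> cylinder S T s\<^sub>I v \<inter> cylinder S T s\<^sub>I w"
    then have "v = w" by (intro nth_equalityI) (auto simp: cylinder_def)
    with * show False by simp
  qed
  moreover have "finite ?W" using finite_words[of "Suc j"] by (rule rev_finite_subset) auto
  ultimately have "emeasure (path_measure S T s\<^sub>I) (\<Union>w\<in>?W. cylinder S T s\<^sub>I w) =
      (\<Sum>w\<in>?W. emeasure (path_measure S T s\<^sub>I) (cylinder S T s\<^sub>I w))"
    by (intro sum_emeasure[symmetric]) (auto simp: sets_path_measure)
  also have "\<dots> = (\<Sum>w\<in>?W. ennreal (word_prob T w))"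
    by (intro sum.cong refl emeasure_cylinder) auto
  also have "\<dots> = ennreal (\<Sum>w\<in>?W. word_prob T w)"
    by (intro sum_ennreal word_prob_nonneg)
  finally show ?thesis unfolding path_prefix_eq_UN .
qed

text \<open>The sigma-algebra is generated by cylinders rather than given as a product, so
  coordinates are handled as entries of a prefix.\<close>

lemma measurable_path_coord [measurable]:
  "(\<lambda>\<pi>. \<pi> i) \<in> measurable (path_measure S T s\<^sub>I) (count_space UNIV)"
proof (rule measurableI)
  fix A :: "'s set"
  have "(\<lambda>\<pi>. \<pi> i) -` A \<inter> space (path_measure S T s\<^sub>I) =
      {\<pi> \<in> paths S T s\<^sub>I. map \<pi> [0..<Suc i] ! i \<in> A}"
    by (auto simp del: upt_Suc)
  then show "(\<lambda>\<pi>. \<pi> i) -` A \<inter> space (path_measure S T s\<^sub>I) \<in> sets (path_measure S T s\<^sub>I)"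
    using sets_path_prefix[of "\<lambda>w. w ! i \<in> A" i] by simp
qed simp

lemma measurable_path_coord_mem [measurable]:
  "Measurable.pred (path_measure S T s\<^sub>I) (\<lambda>\<pi>. \<pi> k \<in> A)"
  by (rule measurable_compose[OF measurable_path_coord]) simp

lemma measurable_le_idx [measurable]:
  "Measurable.pred (path_measure S T s\<^sub>I) (\<lambda>\<pi>. enat i \<le> idx \<pi> G)"
  unfolding enat_le_idx_iff by measurable

lemma measurable_less_idx [measurable]:
  "Measurable.pred (path_measure S T s\<^sub>I) (\<lambda>\<pi>. enat i < idx \<pi> G)"
  unfolding enat_less_idx_iff by measurable

lemma measurable_PR: "PR R G \<in> borel_measurable (path_measure S T s\<^sub>I)"
proof -
  have "(\<lambda>\<pi>. ennreal (R (\<pi> i))) \<in> borel_measurable (path_measure S T s\<^sub>I)" for i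
    by (rule measurable_compose[OF measurable_path_coord]) simp
  then show ?thesis
    unfolding PR_def[abs_def] by measurable
qed

lemma emeasure_less_idx:
  "emeasure (path_measure S T s\<^sub>I) {\<pi> \<in> paths S T s\<^sub>I. enat j < idx \<pi> G} =
     ennreal (avoid_mass S T s\<^sub>I G j)"
proof -
  have "{\<pi> \<in> paths S T s\<^sub>I. enat j < idx \<pi> G} =
      {\<pi> \<in> paths S T s\<^sub>I. set (map \<pi> [0..<Suc j]) \<inter> G = {}}"
    by (fastforce simp: enat_less_idx_iff less_Suc_eq_le simp del: upt_Suc)
  then show ?thesis
    using emeasure_path_prefix[of "\<lambda>w. set w \<inter> G = {}" j]
    by (simp add: avoid_mass_def avoiding_words_def del: upt_Suc)
qed

text \<open>Continuity from above: the events of a first visit after time \<open>j\<close> decrease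
  to the event of no visit.\<close>

lemma avoid_mass_tendsto_0:
  assumes null: "emeasure (path_measure S T s\<^sub>I) {\<pi> \<in> paths S T s\<^sub>I. idx \<pi> G = \<infinity>} = 0"
  shows "avoid_mass S T s\<^sub>I G \<longlonglongrightarrow> 0"
proof -
  interpret P: prob_space "path_measure S T s\<^sub>I" by (rule prob_space_path_measure)
  let ?A = "\<lambda>j. {\<pi> \<in> paths S T s\<^sub>I. enat j < idx \<pi> G}"
  have "?A j \<in> sets (path_measure S T s\<^sub>I)" for j
    using measurable_less_idx[of j G] by (simp add: pred_def)
  moreover have "decseq ?A"
    by (auto simp: decseq_def intro: le_less_trans[rotated])
  ultimately have "(\<lambda>j. measure (path_measure S T s\<^sub>I) (?A j)) \<longlonglongrightarrow>
      measure (path_measure S T s\<^sub>I) (\<Inter>j. ?A j)"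
    by (intro P.finite_Lim_measure_decseq) auto
  moreover have "(\<Inter>j. ?A j) = {\<pi> \<in> paths S T s\<^sub>I. idx \<pi> G = \<infinity>}"
  proof safe
    fix \<pi> assume *: "\<pi> \<in> (\<Inter>j. ?A j)"
    show "idx \<pi> G = \<infinity>"
      using * by (cases "idx \<pi> G") auto
  qed auto
  ultimately show ?thesis
    using null by (simp add: measure_def emeasure_less_idx avoid_mass_nonneg)
qed

section \<open>Accumulated reward for early and for late first visits\<close>

text \<open>The reward at the first visit counts as well, so up to \<open>n + 1\<close> positions
  contribute.\<close>

lemma PR_le:
  assumes "\<pi> \<in> paths S T s\<^sub>I" "idx \<pi> G \<le> enat n" "\<And>s. s \<in> S \<Longrightarrow> R s \<le> r"
  shows "PR R G \<pi> \<le> ennreal (real (Suc n) * r)"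
proof -
  have "i \<le> n" if "enat i \<le> idx \<pi> G" for i
    using order_trans[OF that assms(2)] by simp
  then have "PR R G \<pi> = (\<Sum>i\<le>n. if enat i \<le> idx \<pi> G then ennreal (R (\<pi> i)) else 0)"
    unfolding PR_def by (intro suminf_finite) auto
  also have "\<dots> \<le> (\<Sum>i\<le>n. ennreal r)"
    using assms by (intro sum_mono) (auto simp: paths_def intro!: ennreal_leI)
  also have "\<dots> = ennreal (real (Suc n) * r)"
    by (simp add: ennreal_mult' ennreal_of_nat_eq_real_of_nat del: of_nat_Suc)
  finally show ?thesis .
qed

text \<open>Exchange sum and integral: each position contributes at most \<open>r\<close> times the
  probability that it is counted on the tail event.\<close>

lemma nn_integral_PR_tail_le:
  assumes r: "\<And>s. s \<in> S \<Longrightarrow> R s \<le> r" "0 \<le> r"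
    and C: "\<And>K. (\<Sum>k<K. avoid_mass S T s\<^sub>I G (n + k)) \<le> C"
  shows "(\<integral>\<^sup>+\<pi>. PR R G \<pi> * indicator {\<pi> \<in> paths S T s\<^sub>I. enat n < idx \<pi> G} \<pi> \<partial>path_measure S T s\<^sub>I)
    \<le> ennreal (r * (real (Suc n) * avoid_mass S T s\<^sub>I G n + C))"
proof -
  let ?t = "avoid_mass S T s\<^sub>I G" and ?P = "path_measure S T s\<^sub>I"
  let ?A = "\<lambda>j. {\<pi> \<in> paths S T s\<^sub>I. enat j < idx \<pi> G}"
  \<comment> \<open>Position \<open>i\<close> counts on the tail event exactly when the first visit
    comes after time \<open>?h i\<close>. Positions 0 to \<open>n\<close> thus give
    \<open>n + 1\<close> copies of \<open>?t n\<close>, and position \<open>Suc n + k\<close> gives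
    \<open>?t (n + k)\<close>.\<close>
  let ?h = "\<lambda>i. if i \<le> n then n else i - 1"
  have A: "?A j \<in> sets ?P" for j
    using measurable_less_idx[of j G] by (simp add: pred_def)
  have eq: "enat i \<le> idx \<pi> G \<and> enat n < idx \<pi> G \<longleftrightarrow> enat (?h i) < idx \<pi> G" for i \<pi>
    unfolding enat_le_idx_iff enat_less_idx_iff
    by (cases i) (auto simp: less_Suc_eq_le)
  have pt: "PR R G \<pi> * indicator (?A n) \<pi> \<le> (\<Sum>i. ennreal r * indicator (?A (?h i)) \<pi>)"
    if \<pi>: "\<pi> \<in> paths S T s\<^sub>I" for \<pi>
  proof -
    have "PR R G \<pi> * indicator (?A n) \<pi> =
        (\<Sum>i. (if enat i \<le> idx \<pi> G then ennreal (R (\<pi> i)) else 0) * indicator (?A n) \<pi>)"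
      unfolding PR_def by simp
    also have "\<dots> \<le> (\<Sum>i. ennreal r * indicator (?A (?h i)) \<pi>)"
    proof (rule suminf_le)
      fix i
      have "R (\<pi> i) \<le> r" using \<pi> r by (auto simp: paths_def)
      then show "(if enat i \<le> idx \<pi> G then ennreal (R (\<pi> i)) else 0) * indicator (?A n) \<pi>
          \<le> ennreal r * indicator (?A (?h i)) \<pi>"
        using eq[of i \<pi>] \<pi> by (auto simp: indicator_def intro: ennreal_leI split del: if_split)
    qed auto
    finally show ?thesis .
  qed
  have bnd: "(\<Sum>i<K. ?t (?h i)) \<le> real (Suc n) * ?t n + C" for K
  proof -
    have "(\<Sum>i<K. ?t (?h i)) \<le> (\<Sum>i<Suc n + K. ?t (?h i))"
      by (intro sum_mono2) (auto simp: avoid_mass_nonneg)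
    also have "\<dots> = (\<Sum>i<Suc n. ?t (?h i)) + (\<Sum>k<K. ?t (?h (Suc n + k)))"
      by (induction K) (auto simp: algebra_simps)
    also have "(\<Sum>i<Suc n. ?t (?h i)) = real (Suc n) * ?t n"
      by (simp add: less_Suc_eq_le del: sum.lessThan_Suc)
    also have "(\<Sum>k<K. ?t (?h (Suc n + k))) = (\<Sum>k<K. ?t (n + k))"
      by (intro sum.cong) auto
    finally show ?thesis using C[of K] by linarith
  qed
  have "(\<integral>\<^sup>+\<pi>. PR R G \<pi> * indicator (?A n) \<pi> \<partial>?P) \<le>
      (\<integral>\<^sup>+\<pi>. (\<Sum>i. ennreal r * indicator (?A (?h i)) \<pi>) \<partial>?P)"
    using pt by (intro nn_integral_mono) simp
  also have "\<dots> = (\<Sum>i. \<integral>\<^sup>+\<pi>. ennreal r * indicator (?A (?h i)) \<pi> \<partial>?P)"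
    using A by (intro nn_integral_suminf) (auto intro!: borel_measurable_times_ennreal borel_measurable_indicator)
  also have "\<dots> = (\<Sum>i. ennreal (r * ?t (?h i)))"
    using A by (simp add: nn_integral_cmult_indicator emeasure_less_idx ennreal_mult r avoid_mass_nonneg)
  also have "\<dots> \<le> ennreal (r * (real (Suc n) * ?t n + C))"
  proof (rule suminf_le_const)
    fix K
    have "(\<Sum>i<K. ennreal (r * ?t (?h i))) = ennreal (r * (\<Sum>i<K. ?t (?h i)))"
      using r by (simp add: sum_ennreal avoid_mass_nonneg sum_distrib_left)
    also have "\<dots> \<le> ennreal (r * (real (Suc n) * ?t n + C))"
      using bnd r by (intro ennreal_leI mult_left_mono)
    finally show "(\<Sum>i<K. ennreal (r * ?t (?h i))) \<le> ennreal (r * (real (Suc n) * ?t n + C))" .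
  qed auto
  finally show ?thesis .
qed

lemma nn_integral_PR_tail_le_geometric:
  assumes null: "emeasure (path_measure S T s\<^sub>I) {\<pi> \<in> paths S T s\<^sub>I. idx \<pi> G = \<infinity>} = 0"
    and r: "\<And>s. s \<in> S \<Longrightarrow> R s \<le> r" "0 \<le> r"
    and p: "0 < p" "\<And>s s'. s \<in> S \<Longrightarrow> s' \<in> S \<Longrightarrow> pmf (T s) s' \<noteq> 0 \<Longrightarrow> p \<le> pmf (T s) s'" "p \<le> 1"
    and N: "card S \<le> N"
  shows "(\<integral>\<^sup>+\<pi>. PR R G \<pi> * indicator {\<pi> \<in> paths S T s\<^sub>I. enat (q * N) < idx \<pi> G} \<pi>
      \<partial>path_measure S T s\<^sub>I) \<le> ennreal (real N * r * (1 - p ^ N) ^ q * (real q * p ^ N + 1) / p ^ N)"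
proof -
  let ?t = "avoid_mass S T s\<^sub>I G"
  have "card S \<noteq> 0" using finite_S init_S by auto
  then obtain n where n: "N = Suc n" using N by (cases N) auto
  have decay: "?t (j + n) \<le> (1 - p ^ n) * ?t j" for j
    using avoid_mass_decay[OF p avoid_mass_tendsto_0[OF null]] N n by simp
  have pN: "0 < p ^ N" "p ^ N \<le> p ^ n" "p ^ N \<le> 1"
    using p power_le_one[of p N] power_decreasing[of n N p] by (auto simp: n)
  \<comment> \<open>The power bound uses this weaker decay over \<open>N\<close> steps, because the
    tail starts at time \<open>q * N\<close>. The stronger decay over \<open>n\<close> steps is kept
    for the sum \<open>C\<close>.\<close>
  have "?t (j + N) \<le> (1 - p ^ N) * ?t j" for j
  proof -
    have "?t (j + N) \<le> ?t (j + n)" by (rule antimonoD[OF avoid_mass_antimono]) (simp add: n)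
    also note decay
    also have "(1 - p ^ n) * ?t j \<le> (1 - p ^ N) * ?t j"
      using pN avoid_mass_nonneg by (intro mult_right_mono) auto
    finally show ?thesis .
  qed
  then have tq: "?t (q * N) \<le> (1 - p ^ N) ^ q"
    using pN avoid_mass_le_1 by (intro decay_power_le) auto
  define C where "C = real n * ?t (q * N) / p ^ n"
  have "(\<Sum>k<K. ?t (q * N + k)) \<le> C" for K
    using decay_partial_sum_le[OF avoid_mass_antimono avoid_mass_nonneg decay, where K = K and j = "q * N"] p(1)
    by (simp add: C_def pos_le_divide_eq mult.commute)
  from nn_integral_PR_tail_le[OF r this]
  have "(\<integral>\<^sup>+\<pi>. PR R G \<pi> * indicator {\<pi> \<in> paths S T s\<^sub>I. enat (q * N) < idx \<pi> G} \<pi>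
      \<partial>path_measure S T s\<^sub>I) \<le> ennreal (r * (real (Suc (q * N)) * ?t (q * N) + C))" .
  also have "\<dots> \<le> ennreal (real N * r * (1 - p ^ N) ^ q * (real q * p ^ N + 1) / p ^ N)"
  proof (rule ennreal_leI)
    have "C \<le> real n * ?t (q * N) / p ^ N"
      unfolding C_def using pN avoid_mass_nonneg by (intro divide_left_mono) auto
    then have "real (Suc (q * N)) * ?t (q * N) + C
        \<le> (real (q * N) + 1 + real n / p ^ N) * ?t (q * N)"
      by (simp add: algebra_simps)
    \<comment> \<open>Enlarging the extra 1 to \<open>1 / p ^ N\<close> completes
      \<open>n / p ^ N\<close> to \<open>N / p ^ N\<close>, so that \<open>N\<close> factors
      out.\<close>
    also have "\<dots> \<le> (real (q * N) + 1 / p ^ N + real n / p ^ N) * ?t (q * N)"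
      using pN avoid_mass_nonneg by (intro mult_right_mono add_mono) auto
    also have "real (q * N) + 1 / p ^ N + real n / p ^ N = real N * (real q * p ^ N + 1) / p ^ N"
      using p(1) by (simp add: n field_simps)
    also have "\<dots> * ?t (q * N) \<le> real N * (real q * p ^ N + 1) / p ^ N * (1 - p ^ N) ^ q"
      using tq p(1) by (intro mult_left_mono) auto
    finally have "r * (real (Suc (q * N)) * ?t (q * N) + C) \<le>
        r * (real N * (real q * p ^ N + 1) / p ^ N * (1 - p ^ N) ^ q)"
      using r(2) by (rule mult_left_mono)
    then show "r * (real (Suc (q * N)) * ?t (q * N) + C) \<le>
        real N * r * (1 - p ^ N) ^ q * (real q * p ^ N + 1) / p ^ N"
      by (simp add: mult_ac)
  qed
  finally show ?thesis .
qed

section \<open>The exact constants \<open>r_max\<close> and \<open>p_min\<close>\<close>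

lemma R_le_r_max: "s \<in> S \<Longrightarrow> R s \<le> r_max S R"
  unfolding r_max_def using finite_S by (intro Max_ge) (auto simp: setcompr_eq_image)

lemma finite_pmf_values: "finite {pmf (T s) s' | s s'. s \<in> S \<and> s' \<in> S}"
  using finite_S by (simp add: finite_image_set2)

lemma p_min_le: "s \<in> S \<Longrightarrow> s' \<in> S \<Longrightarrow> pmf (T s) s' \<noteq> 0 \<Longrightarrow> p_min S T \<le> pmf (T s) s'"
  unfolding p_min_def using finite_pmf_values by (intro Min_le) auto

text \<open>The initial state has a successor of positive probability, so the minimum ranges over a
  nonempty set.\<close>

lemma p_min_le_1: "p_min S T \<le> 1"
proof -
  obtain s' where "s' \<in> set_pmf (T s\<^sub>I)" using set_pmf_not_empty[of "T s\<^sub>I"] by blast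
  then have "p_min S T \<le> pmf (T s\<^sub>I) s'"
    using init_S T_closed[OF init_S] by (intro p_min_le) (auto simp: set_pmf_eq)
  also have "\<dots> \<le> 1" by (rule pmf_le_1)
  finally show ?thesis .
qed

end

section \<open>Assembling the bounding set, with a case split on the size of
  \<open>p ^ N\<close>\<close>

theorem lemma1:
  fixes S G :: "'s set" and R :: "'s \<Rightarrow> real" and T :: "'s \<Rightarrow> 's pmf" and s\<^sub>I :: 's
    and N q :: nat and r p \<epsilon> :: real
  assumes "dtmc S R T s\<^sub>I"
    and "G \<subseteq> S"
    and "expected_reach_reward S R T s\<^sub>I G < \<infinity>"
    and "card S \<le> N"
    and "r_max S R \<le> r"
    and "0 < p" and "p \<le> p_min S T"
    and "0 < \<epsilon>"
    and "real N * r * (1 - p ^ N) ^ q * (real q - real q * p ^ N + 1) * p powi (- int N) < \<epsilon>"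
  shows "bounding_set (path_measure S T s\<^sub>I) \<epsilon> (PR R G)
           {\<pi> \<in> paths S T s\<^sub>I. idx \<pi> G \<le> enat (q * N)}"
proof -
  interpret dtmc S R T s\<^sub>I by (rule assms(1))
  let ?P = "path_measure S T s\<^sub>I"
  let ?B = "{\<pi> \<in> paths S T s\<^sub>I. idx \<pi> G \<le> enat (q * N)}"
  let ?A = "{\<pi> \<in> paths S T s\<^sub>I. enat (q * N) < idx \<pi> G}"
  \<comment> \<open>Missing \<open>G\<close> with positive probability would make the expected
    reward infinite by definition, so finiteness yields both facts.\<close>
  have null: "emeasure ?P {\<pi> \<in> paths S T s\<^sub>I. idx \<pi> G = \<infinity>} = 0"
    and fin: "(\<integral>\<^sup>+\<pi>. PR R G \<pi> \<partial>?P) < \<infinity>"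
    using assms(3) by (auto simp: expected_reach_reward_def split: if_splits)
  have Rr: "R s \<le> r" if "s \<in> S" for s using R_le_r_max[OF that] assms(5) by simp
  have r0: "0 \<le> r" using Rr[OF init_S] R_nonneg[OF init_S] by simp
  have p1: "p \<le> 1" using assms(7) p_min_le_1 by simp
  have pT: "p \<le> pmf (T s) s'" if "s \<in> S" "s' \<in> S" "pmf (T s) s' \<noteq> 0" for s s'
    using p_min_le[OF that] assms(7) by simp
  have "card S \<noteq> 0" using finite_S init_S by auto
  then have N: "0 < N" using assms(4) by simp
  have pN: "0 < p ^ N" "p ^ N \<le> 1" using assms(6) p1 by (auto simp: power_le_one)
  let ?b = "real N * r * (1 - p ^ N) ^ q * (real q - real q * p ^ N + 1) / p ^ N"
  have b: "?b < \<epsilon>"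
    using assms(9) by (simp add: power_int_minus divide_inverse)
  have tail: "(\<integral>\<^sup>+\<pi>. PR R G \<pi> * indicator ?A \<pi> \<partial>?P) \<le> ennreal ?b"
  proof (cases "p ^ N \<le> 1 / 2")
    case True
    have "real q * p ^ N \<le> real q * (1 - p ^ N)"
      using True by (intro mult_left_mono) auto
    then have "real N * r * (1 - p ^ N) ^ q * (real q * p ^ N + 1) / p ^ N \<le> ?b"
      using pN r0 by (intro divide_right_mono mult_left_mono) (auto simp: algebra_simps)
    then show ?thesis
      using nn_integral_PR_tail_le_geometric[OF null Rr r0 assms(6) pT p1 assms(4), of q]
      by (meson ennreal_leI order_trans)
  next
    case False
    \<comment> \<open>All transitions are deterministic, so the geometric bound holds with \<open>1\<close> in place of \<open>p\<close>.\<close>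
    have "p ^ N \<le> p" using N assms(6) p1 power_decreasing[of 1 N p] by simp
    then have half: "1 / 2 < pmf (T s) s'" if "s \<in> S" "pmf (T s) s' \<noteq> 0" for s s'
      using pT[OF that(1) _ that(2)] T_closed[OF that(1)] that False by (force simp: set_pmf_iff)
    have one: "1 \<le> pmf (T s) s'" if "s \<in> S" "s' \<in> S" "pmf (T s) s' \<noteq> 0" for s s'
      using pmf_eq_1_if_all_gt_half[OF half[OF that(1)] that(3)] by simp
    \<comment> \<open>The left side is 0 for positive \<open>q\<close>. For \<open>q = 0\<close> the
      convention \<open>0 ^ 0 = 1\<close> makes it \<open>N * r\<close>, which is at most
      \<open>N * r / p ^ N\<close>.\<close>
    have "real N * r * (1 - 1 ^ N) ^ q * (real q * 1 ^ N + 1) / 1 ^ N \<le> ?b"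
    proof (cases q)
      case 0
      have "real N * r * p ^ N \<le> real N * r"
        using pN r0 by (intro mult_left_le) auto
      with 0 pN show ?thesis by (simp add: pos_le_divide_eq)
    next
      case (Suc k)
      have "real q * p ^ N \<le> real q" using pN by (intro mult_left_le) auto
      then have "0 \<le> ?b" using pN r0 by (intro divide_nonneg_nonneg mult_nonneg_nonneg) auto
      with Suc show ?thesis by simp
    qed
    then show ?thesis
      using nn_integral_PR_tail_le_geometric[OF null Rr r0 zero_less_one one order_refl assms(4), of q]
      by (meson ennreal_leI order_trans)
  qed
  have "space ?P - ?B = ?A" by auto
  \<comment> \<open>Positivity of \<epsilon> lets the strict real inequality survive the truncation
    by \<open>ennreal\<close>.\<close>
  then have "(\<integral>\<^sup>+\<pi>\<in>space ?P - ?B. PR R G \<pi> \<partial>?P) < ennreal \<epsilon>"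
    using tail b assms(8) by (simp only:) (rule le_less_trans, assumption, simp add: ennreal_lessI)
  moreover have "?B \<in> sets ?P"
  proof -
    have "?A \<in> sets ?P" using measurable_less_idx[of "q * N" G] by (simp add: pred_def)
    then have "space ?P - ?A \<in> sets ?P" by (rule sets.compl_sets)
    also have "space ?P - ?A = ?B" by auto
    finally show ?thesis .
  qed
  \<comment> \<open>On \<open>?B\<close> at most \<open>q * N + 1\<close> rewards are added, each
    between 0 and \<open>r\<close>; this supplies the interval.\<close>
  moreover have "\<forall>\<pi>\<in>?B. ereal 0 \<le> enn2ereal (PR R G \<pi>) \<and>
      enn2ereal (PR R G \<pi>) \<le> ereal (real (Suc (q * N)) * r)"
  proof (intro ballI conjI)
    fix \<pi> assume "\<pi> \<in> ?B"
    then have "enn2ereal (PR R G \<pi>) \<le> enn2ereal (ennreal (real (Suc (q * N)) * r))"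
      using Rr by (intro PR_le less_eq_ennreal.rep_eq[THEN iffD1]) auto
    then show "enn2ereal (PR R G \<pi>) \<le> ereal (real (Suc (q * N)) * r)"
      using r0 by (simp add: enn2ereal_ennreal del: of_nat_Suc)
  qed (simp flip: zero_ereal_def)
  moreover have "0 \<le> real (Suc (q * N)) * r" using r0 by simp
  ultimately show ?thesis
    unfolding bounding_set_def using prob_space_path_measure measurable_PR fin by blast
qed

end
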